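(* The assignments $H\mapsto H^{\mathsf{IS}}$ and $f\mapsto f^{\mathsf{IS}}$ define a functor $(\ )^{\mathsf{IS}}:\mathsf{Hil}\to\mathsf{IS}$.
   Context: A Hilbert algebra is an algebra $(H,\to,1)$ of type $(2,0)$ such that for all $a,b,c\in H$: $a\to(b\to a)=1$; $(a\to(b\to c))\to((a\to b)\to(a\to c))=1$; and $a\to b=b\to a=1$ implies $a=b$. $\mathsf{Hil}$ is the category of Hilbert algebras and homomorphisms. An implicative semilattice is an algebra $(H,\wedge,\to)$ such that $(H,\wedge)$ is a meet semilattice and, for all $a,b,c$, $a\wedge b\le c$ iff $a\le b\to c$; it has a greatest element $1$, which is included in the language. $\mathsf{IS}$ is the category of implicative semilattices and homomorphisms (maps preserving $\wedge,\to,1$). An implicative filter of a Hilbert algebra $H$ is a subset $F\subseteq H$ with $1\in F$ and such that $a\in F$, $a\to b\in F$ imply $b\in F$. It is irreducible if it is proper ($F\ne H$) and, for all implicative filters $F_1,F_2$, $F=F_1\cap F_2$ implies $F=F_1$ or $F=F_2$. $X(H)$ is the set of irreducible implicative filters of $H$, ordered by inclusion. For $a\in H$, $\varphi(a)=\{P\in X(H):a\in P\}$. $X(H)^+$ is the set of upsets of $(X(H),\subseteq)$, a complete Heyting algebra under $\cap,\cup$ and $U\Rightarrow V=(U\cap V^c]^c$, where $(Y]$ is the downset generated by $Y$ and $Y^c$ the complement in $X(H)$. $H^{\mathsf{IS}}$ is the implicative subsemilattice (closed under $\cap$, $\Rightarrow$, top $X(H)$) of $X(H)^+$ generated by $\varphi[H]$.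 For a homomorphism $f:H\to G$ of Hilbert algebras, $R_f\subseteq X(G)\times X(H)$ is defined by $(P,Q)\in R_f$ iff $f^{-1}(P)\subseteq Q$, and $R_f(P)=\{Q\in X(H):(P,Q)\in R_f\}$. The map $f^{\mathsf{IS}}:H^{\mathsf{IS}}\to G^{\mathsf{IS}}$ is $f^{\mathsf{IS}}(U)=\{P\in X(G):R_f(P)\subseteq U\}$. *)

theory Defs
  imports Main "HOL-Library.FuncSet" "HOL-Algebra.Congruence"
begin

section \<open>Categories and functors\<close>

text \<open>
  Categories are given by hom-sets, which need not be disjoint; consequently composition and the
  arrow part of a functor take the objects involved as arguments.
  \<open>Comp C A B D g f\<close> is the composite of \<open>f : A \<rightarrow> B\<close> and \<open>g : B \<rightarrow> D\<close>.
\<close>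

record ('o, 'm) cat =
  Obj :: "'o set"
  Hom :: "'o \<Rightarrow> 'o \<Rightarrow> 'm set"
  Id :: "'o \<Rightarrow> 'm"
  Comp :: "'o \<Rightarrow> 'o \<Rightarrow> 'o \<Rightarrow> 'm \<Rightarrow> 'm \<Rightarrow> 'm"

locale category =
  fixes C :: "('o, 'm) cat"
  assumes Id_in_Hom: "A \<in> Obj C \<Longrightarrow> Id C A \<in> Hom C A A"
    and Comp_in_Hom: "\<lbrakk>A \<in> Obj C; B \<in> Obj C; D \<in> Obj C; f \<in> Hom C A B; g \<in> Hom C B D\<rbrakk>
      \<Longrightarrow> Comp C A B D g f \<in> Hom C A D"
    and Comp_Id_right: "\<lbrakk>A \<in> Obj C; B \<in> Obj C; f \<in> Hom C A B\<rbrakk> \<Longrightarrow> Comp C A A B f (Id C A) = f"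
    and Comp_Id_left: "\<lbrakk>A \<in> Obj C; B \<in> Obj C; f \<in> Hom C A B\<rbrakk> \<Longrightarrow> Comp C A B B (Id C B) f = f"
    and Comp_assoc: "\<lbrakk>A \<in> Obj C; B \<in> Obj C; D \<in> Obj C; E \<in> Obj C;
        f \<in> Hom C A B; g \<in> Hom C B D; h \<in> Hom C D E\<rbrakk>
      \<Longrightarrow> Comp C A D E h (Comp C A B D g f) = Comp C A B E (Comp C B D E h g) f"

locale cat_functor = source: category C + target: category D
  for C :: "('o, 'm) cat" and D :: "('p, 'n) cat" +
  fixes F :: "'o \<Rightarrow> 'p" and Fa :: "'o \<Rightarrow> 'o \<Rightarrow> 'm \<Rightarrow> 'n"
  assumes obj: "A \<in> Obj C \<Longrightarrow> F A \<in> Obj D"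
    and arr: "\<lbrakk>A \<in> Obj C; B \<in> Obj C; f \<in> Hom C A B\<rbrakk> \<Longrightarrow> Fa A B f \<in> Hom D (F A) (F B)"
    and ident: "A \<in> Obj C \<Longrightarrow> Fa A A (Id C A) = Id D (F A)"
    and comp: "\<lbrakk>A \<in> Obj C; B \<in> Obj C; E \<in> Obj C; f \<in> Hom C A B; g \<in> Hom C B E\<rbrakk>
      \<Longrightarrow> Fa A E (Comp C A B E g f) = Comp D (F A) (F B) (F E) (Fa B E g) (Fa A B f)"


section \<open>Hilbert algebras\<close>

record 'a hilb = "'a partial_object" +
  imp :: "'a \<Rightarrow> 'a \<Rightarrow> 'a"  (infixr "\<rightarrow>\<index>" 60)
  top_el :: "'a"  ("\<top>\<index>")

locale hilbert_algebra =
  fixes H (structure)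
  assumes top_closed: "\<top> \<in> carrier H"
    and imp_closed: "\<lbrakk>a \<in> carrier H; b \<in> carrier H\<rbrakk> \<Longrightarrow> a \<rightarrow> b \<in> carrier H"
    and imp_K: "\<lbrakk>a \<in> carrier H; b \<in> carrier H\<rbrakk> \<Longrightarrow> a \<rightarrow> (b \<rightarrow> a) = \<top>"
    and imp_S: "\<lbrakk>a \<in> carrier H; b \<in> carrier H; c \<in> carrier H\<rbrakk>
      \<Longrightarrow> (a \<rightarrow> (b \<rightarrow> c)) \<rightarrow> ((a \<rightarrow> b) \<rightarrow> (a \<rightarrow> c)) = \<top>"
    and imp_antisym: "\<lbrakk>a \<in> carrier H; b \<in> carrier H; a \<rightarrow> b = \<top>; b \<rightarrow> a = \<top>\<rbrakk> \<Longrightarrow> a = b"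

text \<open>
  Homomorphisms are extensional functions on the carrier (\<open>undefined\<close> elsewhere), so that equality
  of arrows is equality of maps between carriers.
\<close>

definition hilb_hom :: "'a hilb \<Rightarrow> 'b hilb \<Rightarrow> ('a \<Rightarrow> 'b) set" where
  "hilb_hom H G = {f \<in> carrier H \<rightarrow>\<^sub>E carrier G.
     f \<top>\<^bsub>H\<^esub> = \<top>\<^bsub>G\<^esub> \<and>
     (\<forall>a\<in>carrier H. \<forall>b\<in>carrier H. f (a \<rightarrow>\<^bsub>H\<^esub> b) = f a \<rightarrow>\<^bsub>G\<^esub> f b)}"

text \<open>Hilbert algebras whose carrier is an arbitrary subset of the type \<open>'a\<close>.\<close>

definition Hil :: "('a hilb, 'a \<Rightarrow> 'a) cat" where
  "Hil = \<lparr>Obj = Collect hilbert_algebra,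
          Hom = hilb_hom,
          Id = (\<lambda>H. \<lambda>a\<in>carrier H. a),
          Comp = (\<lambda>H G K g f. compose (carrier H) g f)\<rparr>"


section \<open>Implicative semilattices\<close>

record 'a imp_semilat = "'a hilb" +
  meet :: "'a \<Rightarrow> 'a \<Rightarrow> 'a"  (infixl "\<sqinter>\<index>" 70)

definition meet_le :: "'a imp_semilat \<Rightarrow> 'a \<Rightarrow> 'a \<Rightarrow> bool"  (infix "\<sqsubseteq>\<index>" 50) where
  "a \<sqsubseteq>\<^bsub>L\<^esub> b \<longleftrightarrow> a \<sqinter>\<^bsub>L\<^esub> b = a"

locale implicative_semilattice =
  fixes L :: "'a imp_semilat" (structure)
  assumes top_closed: "\<top> \<in> carrier L"
    and meet_closed: "\<lbrakk>a \<in> carrier L; b \<in> carrier L\<rbrakk> \<Longrightarrow> a \<sqinter> b \<in> carrier L"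
    and imp_closed: "\<lbrakk>a \<in> carrier L; b \<in> carrier L\<rbrakk> \<Longrightarrow> a \<rightarrow> b \<in> carrier L"
    and meet_idem: "a \<in> carrier L \<Longrightarrow> a \<sqinter> a = a"
    and meet_comm: "\<lbrakk>a \<in> carrier L; b \<in> carrier L\<rbrakk> \<Longrightarrow> a \<sqinter> b = b \<sqinter> a"
    and meet_assoc: "\<lbrakk>a \<in> carrier L; b \<in> carrier L; c \<in> carrier L\<rbrakk>
      \<Longrightarrow> (a \<sqinter> b) \<sqinter> c = a \<sqinter> (b \<sqinter> c)"
    and residuation: "\<lbrakk>a \<in> carrier L; b \<in> carrier L; c \<in> carrier L\<rbrakk>
      \<Longrightarrow> a \<sqinter> b \<sqsubseteq> c \<longleftrightarrow> a \<sqsubseteq> b \<rightarrow> c"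
    and top_greatest: "a \<in> carrier L \<Longrightarrow> a \<sqsubseteq> \<top>"

definition imp_semilat_hom :: "'a imp_semilat \<Rightarrow> 'b imp_semilat \<Rightarrow> ('a \<Rightarrow> 'b) set" where
  "imp_semilat_hom L M = {h \<in> carrier L \<rightarrow>\<^sub>E carrier M.
     h \<top>\<^bsub>L\<^esub> = \<top>\<^bsub>M\<^esub> \<and>
     (\<forall>a\<in>carrier L. \<forall>b\<in>carrier L. h (a \<sqinter>\<^bsub>L\<^esub> b) = h a \<sqinter>\<^bsub>M\<^esub> h b) \<and>
     (\<forall>a\<in>carrier L. \<forall>b\<in>carrier L. h (a \<rightarrow>\<^bsub>L\<^esub> b) = h a \<rightarrow>\<^bsub>M\<^esub> h b)}"

definition IS :: "('a imp_semilat, 'a \<Rightarrow> 'a) cat" where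
  "IS = \<lparr>Obj = Collect implicative_semilattice,
         Hom = imp_semilat_hom,
         Id = (\<lambda>L. \<lambda>a\<in>carrier L. a),
         Comp = (\<lambda>L M N h g. compose (carrier L) h g)\<rparr>"


section \<open>Irreducible implicative filters\<close>

definition implicative_filter :: "'a hilb \<Rightarrow> 'a set \<Rightarrow> bool" where
  "implicative_filter H F \<longleftrightarrow> F \<subseteq> carrier H \<and> \<top>\<^bsub>H\<^esub> \<in> F \<and>
     (\<forall>a\<in>carrier H. \<forall>b\<in>carrier H. a \<in> F \<longrightarrow> a \<rightarrow>\<^bsub>H\<^esub> b \<in> F \<longrightarrow> b \<in> F)"

definition irreducible_filter :: "'a hilb \<Rightarrow> 'a set \<Rightarrow> bool" where
  "irreducible_filter H F \<longleftrightarrow> implicative_filter H F \<and> F \<noteq> carrier H \<and>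
     (\<forall>F1 F2. implicative_filter H F1 \<longrightarrow> implicative_filter H F2 \<longrightarrow>
        F = F1 \<inter> F2 \<longrightarrow> F = F1 \<or> F = F2)"

definition X :: "'a hilb \<Rightarrow> 'a set set" where
  "X H = {P. irreducible_filter H P}"

definition phi :: "'a hilb \<Rightarrow> 'a \<Rightarrow> 'a set set" where
  "phi H a = {P \<in> X H. a \<in> P}"


section \<open>The implicative semilattice generated by a Hilbert algebra\<close>

definition X_upsets :: "'a hilb \<Rightarrow> 'a set set set" where
  "X_upsets H = {U. U \<subseteq> X H \<and> (\<forall>P\<in>U. \<forall>Q\<in>X H. P \<subseteq> Q \<longrightarrow> Q \<in> U)}"

definition X_down :: "'a hilb \<Rightarrow> 'a set set \<Rightarrow> 'a set set" where
  "X_down H Y = {P \<in> X H. \<exists>Q\<in>Y. P \<subseteq> Q}"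

definition X_imp :: "'a hilb \<Rightarrow> 'a set set \<Rightarrow> 'a set set \<Rightarrow> 'a set set" where
  "X_imp H U V = X H - X_down H (U \<inter> (X H - V))"

definition X_subsemilat :: "'a hilb \<Rightarrow> 'a set set set \<Rightarrow> bool" where
  "X_subsemilat H S \<longleftrightarrow> S \<subseteq> X_upsets H \<and> X H \<in> S \<and>
     (\<forall>U\<in>S. \<forall>V\<in>S. U \<inter> V \<in> S) \<and> (\<forall>U\<in>S. \<forall>V\<in>S. X_imp H U V \<in> S)"

definition IS_obj :: "'a hilb \<Rightarrow> 'a set set imp_semilat" where
  "IS_obj H = \<lparr>carrier = \<Inter>{S. X_subsemilat H S \<and> phi H ` carrier H \<subseteq> S},
               imp = X_imp H,
               top_el = X H,
               meet = (\<inter>)\<rparr>"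

definition R_rel :: "'a hilb \<Rightarrow> 'b hilb \<Rightarrow> ('a \<Rightarrow> 'b) \<Rightarrow> ('b set \<times> 'a set) set" where
  "R_rel H G f = {(P, Q). P \<in> X G \<and> Q \<in> X H \<and> (f -` P \<inter> carrier H) \<subseteq> Q}"

definition IS_map :: "'a hilb \<Rightarrow> 'b hilb \<Rightarrow> ('a \<Rightarrow> 'b) \<Rightarrow> 'a set set \<Rightarrow> 'b set set" where
  "IS_map H G f = (\<lambda>U\<in>carrier (IS_obj H). {P \<in> X G. R_rel H G f `` {P} \<subseteq> U})"

end

theory Submission imports Defs begin

text \<open>
  For a homomorphism \<open>f : H \<rightarrow> G\<close> the map \<open>f\<^sup>I\<^sup>S\<close> is the box operator \<open>U \<mapsto> {P. R_f(P) \<subseteq> U}\<close> of the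
  relation \<open>R_f\<close>, so it preserves finite meets for free. Everything else rests on two ways of
  enlarging an implicative filter to an irreducible one, both obtained from Zorn's lemma.

  \<^item> A filter \<open>F\<close> that misses \<open>a\<close> extends to an irreducible filter that misses \<open>a\<close>
    (\<open>irreducible_separation\<close>). Applied to \<open>f\<^sup>-\<^sup>1(P)\<close>, this gives that the box of \<open>\<phi>(a)\<close> is \<open>\<phi>(f(a))\<close>,
    so generators go to generators.
  \<^item> If \<open>F\<close> is a filter of \<open>G\<close> and \<open>Q\<close> an irreducible filter of \<open>H\<close> with \<open>f\<^sup>-\<^sup>1(F) \<subseteq> Q\<close>, then \<open>F\<close> extends
    to an irreducible filter \<open>P\<close> with \<open>f\<^sup>-\<^sup>1(P) = Q\<close> (\<open>irreducible_lifting\<close>). This is a strong form of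
    the back condition on \<open>R_f\<close>: it turns the obvious inclusion
    \<open>f\<^sup>I\<^sup>S(U \<Rightarrow> V) \<subseteq> f\<^sup>I\<^sup>S(U) \<Rightarrow> f\<^sup>I\<^sup>S(V)\<close> into an equality. It also applies to
    \<open>F = g\<^sup>-\<^sup>1(P)\<close>, a filter that may fail to be irreducible, and yields that the relation of
    \<open>g \<circ> f\<close> factors through those of \<open>g\<close> and \<open>f\<close>, which is compatibility with composition.

  Preservation of identities says that an upset is its own box along \<open>\<subseteq>\<close>. Both the preservation of
  \<open>\<Rightarrow>\<close> and the composition law hold for the box on all upsets; the generated
  subsemilattices enter only to see that \<open>f\<^sup>I\<^sup>S\<close> maps \<open>H\<^sup>I\<^sup>S\<close> into \<open>G\<^sup>I\<^sup>S\<close>, and there it is enough that the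
  upsets sent into \<open>G\<^sup>I\<^sup>S\<close> form a subsemilattice containing the generators.
\<close>

section \<open>The categories of Hilbert algebras and of implicative semilattices\<close>

lemma category_Hil: "category Hil"
proof
  fix A B D E :: "'a hilb" and f g h :: "'a \<Rightarrow> 'a"
  show "A \<in> Obj Hil \<Longrightarrow> Id Hil A \<in> Hom Hil A A"
    by (auto simp: Hil_def hilb_hom_def hilbert_algebra.imp_closed hilbert_algebra.top_closed)
  show "\<lbrakk>A \<in> Obj Hil; B \<in> Obj Hil; D \<in> Obj Hil; f \<in> Hom Hil A B; g \<in> Hom Hil B D\<rbrakk>
      \<Longrightarrow> Comp Hil A B D g f \<in> Hom Hil A D"
    by (auto simp: Hil_def hilb_hom_def compose_def hilbert_algebra.imp_closed
        hilbert_algebra.top_closed PiE_iff)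
  show "\<lbrakk>A \<in> Obj Hil; B \<in> Obj Hil; f \<in> Hom Hil A B\<rbrakk> \<Longrightarrow> Comp Hil A A B f (Id Hil A) = f"
    by (auto simp: Hil_def hilb_hom_def PiE_def intro: compose_Id)
  show "\<lbrakk>A \<in> Obj Hil; B \<in> Obj Hil; f \<in> Hom Hil A B\<rbrakk> \<Longrightarrow> Comp Hil A B B (Id Hil B) f = f"
    by (auto simp: Hil_def hilb_hom_def PiE_def intro: Id_compose)
  show "\<lbrakk>A \<in> Obj Hil; B \<in> Obj Hil; D \<in> Obj Hil; E \<in> Obj Hil;
        f \<in> Hom Hil A B; g \<in> Hom Hil B D; h \<in> Hom Hil D E\<rbrakk>
      \<Longrightarrow> Comp Hil A D E h (Comp Hil A B D g f) = Comp Hil A B E (Comp Hil B D E h g) f"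
    by (auto simp: Hil_def hilb_hom_def PiE_def intro: compose_assoc)
qed

lemma category_IS: "category IS"
proof
  fix A B D E :: "'a imp_semilat" and f g h :: "'a \<Rightarrow> 'a"
  show "A \<in> Obj IS \<Longrightarrow> Id IS A \<in> Hom IS A A"
    by (auto simp: IS_def imp_semilat_hom_def implicative_semilattice.imp_closed
        implicative_semilattice.meet_closed implicative_semilattice.top_closed)
  show "\<lbrakk>A \<in> Obj IS; B \<in> Obj IS; D \<in> Obj IS; f \<in> Hom IS A B; g \<in> Hom IS B D\<rbrakk>
      \<Longrightarrow> Comp IS A B D g f \<in> Hom IS A D"
    by (auto simp: IS_def imp_semilat_hom_def compose_def implicative_semilattice.imp_closed
        implicative_semilattice.meet_closed implicative_semilattice.top_closed PiE_iff)
  show "\<lbrakk>A \<in> Obj IS; B \<in> Obj IS; f \<in> Hom IS A B\<rbrakk> \<Longrightarrow> Comp IS A A B f (Id IS A) = f"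
    by (auto simp: IS_def imp_semilat_hom_def PiE_def intro: compose_Id)
  show "\<lbrakk>A \<in> Obj IS; B \<in> Obj IS; f \<in> Hom IS A B\<rbrakk> \<Longrightarrow> Comp IS A B B (Id IS B) f = f"
    by (auto simp: IS_def imp_semilat_hom_def PiE_def intro: Id_compose)
  show "\<lbrakk>A \<in> Obj IS; B \<in> Obj IS; D \<in> Obj IS; E \<in> Obj IS;
        f \<in> Hom IS A B; g \<in> Hom IS B D; h \<in> Hom IS D E\<rbrakk>
      \<Longrightarrow> Comp IS A D E h (Comp IS A B D g f) = Comp IS A B E (Comp IS B D E h g) f"
    by (auto simp: IS_def imp_semilat_hom_def PiE_def intro: compose_assoc)
qed

section \<open>Implicative filters\<close>

lemma implicative_filterI:
  assumes "F \<subseteq> carrier H" and "\<top>\<^bsub>H\<^esub> \<in> F"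
    and "\<And>a b. \<lbrakk>a \<in> carrier H; b \<in> carrier H; a \<in> F; a \<rightarrow>\<^bsub>H\<^esub> b \<in> F\<rbrakk> \<Longrightarrow> b \<in> F"
  shows "implicative_filter H F"
  unfolding implicative_filter_def
  by (intro conjI ballI impI) (rule assms(1), rule assms(2), rule assms(3))

lemma implicative_filter_mp:
  assumes "implicative_filter H F" and "a \<in> F" and "b \<in> carrier H" and "a \<rightarrow>\<^bsub>H\<^esub> b \<in> F"
  shows "b \<in> F"
proof -
  have sub: "F \<subseteq> carrier H"
    and mp: "\<forall>a\<in>carrier H. \<forall>b\<in>carrier H. a \<in> F \<longrightarrow> a \<rightarrow>\<^bsub>H\<^esub> b \<in> F \<longrightarrow> b \<in> F"
    using assms(1) unfolding implicative_filter_def by blast+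
  show ?thesis
    by (rule mp[rule_format, OF subsetD[OF sub assms(2)] assms(3,2,4)])
qed

lemma implicative_filter_subset: "implicative_filter H F \<Longrightarrow> F \<subseteq> carrier H"
  by (simp add: implicative_filter_def)

lemma implicative_filter_top: "implicative_filter H F \<Longrightarrow> \<top>\<^bsub>H\<^esub> \<in> F"
  by (simp add: implicative_filter_def)

lemma X_implicative_filter: "P \<in> X H \<Longrightarrow> implicative_filter H P"
  by (simp add: X_def irreducible_filter_def)

lemma X_neq_carrier: "P \<in> X H \<Longrightarrow> P \<noteq> carrier H"
  by (simp add: X_def irreducible_filter_def)

text \<open>
  The deduction theorem in semantic form: the elements that become derivable from \<open>F\<close> once \<open>c\<close> is
  assumed form a filter containing \<open>F\<close> and \<open>c\<close>.
\<close>

lemma adjoin_implicative_filter: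
  assumes "hilbert_algebra H" and F: "implicative_filter H F" and c: "c \<in> carrier H"
  shows "implicative_filter H {b \<in> carrier H. c \<rightarrow>\<^bsub>H\<^esub> b \<in> F}" (is "implicative_filter H ?F")
    and "F \<subseteq> {b \<in> carrier H. c \<rightarrow>\<^bsub>H\<^esub> b \<in> F}"
    and "c \<in> {b \<in> carrier H. c \<rightarrow>\<^bsub>H\<^esub> b \<in> F}"
proof -
  interpret hilbert_algebra H by fact
  note top = implicative_filter_top[OF F]
  have weaken: "c \<rightarrow>\<^bsub>H\<^esub> b \<in> F" if "b \<in> F" for b
  proof -
    have b: "b \<in> carrier H"
      using that implicative_filter_subset[OF F] by blast
    show ?thesis
      by (rule implicative_filter_mp[OF F that]) (simp_all add: imp_closed imp_K b c top)
  qed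
  have distrib: "c \<rightarrow>\<^bsub>H\<^esub> b \<in> F"
    if ab: "a \<in> carrier H" "b \<in> carrier H" and F1: "c \<rightarrow>\<^bsub>H\<^esub> a \<in> F"
      and F2: "c \<rightarrow>\<^bsub>H\<^esub> (a \<rightarrow>\<^bsub>H\<^esub> b) \<in> F" for a b
  proof -
    have "(c \<rightarrow>\<^bsub>H\<^esub> a) \<rightarrow>\<^bsub>H\<^esub> (c \<rightarrow>\<^bsub>H\<^esub> b) \<in> F"
      by (rule implicative_filter_mp[OF F F2]) (simp_all add: imp_closed imp_S ab c top)
    then show ?thesis
      by (rule implicative_filter_mp[OF F F1 imp_closed[OF c ab(2)]])
  qed
  show "implicative_filter H ?F"
  proof (rule implicative_filterI)
    show "\<top>\<^bsub>H\<^esub> \<in> ?F"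
      by (simp add: top_closed weaken top)
    show "b \<in> ?F" if "a \<in> carrier H" "b \<in> carrier H" "a \<in> ?F" "a \<rightarrow>\<^bsub>H\<^esub> b \<in> ?F" for a b
      using distrib[of a b] that by simp
  qed simp
  show "F \<subseteq> ?F"
    using weaken implicative_filter_subset[OF F] by blast
  \<comment> \<open>The combinatory derivation of identity as S K K.\<close>
  have "c \<rightarrow>\<^bsub>H\<^esub> c \<in> F"
    using distrib[of "c \<rightarrow>\<^bsub>H\<^esub> c" c] c top by (simp add: imp_closed imp_K)
  with c show "c \<in> ?F" by simp
qed

lemma vimage_implicative_filter:
  assumes "hilbert_algebra H" and "f \<in> hilb_hom H G" and F: "implicative_filter G F"
  shows "implicative_filter H (f -` F \<inter> carrier H)"
proof -
  interpret hilbert_algebra H by fact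
  have f: "\<And>a. a \<in> carrier H \<Longrightarrow> f a \<in> carrier G" "f \<top>\<^bsub>H\<^esub> = \<top>\<^bsub>G\<^esub>"
    "\<And>a b. \<lbrakk>a \<in> carrier H; b \<in> carrier H\<rbrakk> \<Longrightarrow> f (a \<rightarrow>\<^bsub>H\<^esub> b) = f a \<rightarrow>\<^bsub>G\<^esub> f b"
    using assms(2) by (auto simp: hilb_hom_def)
  show ?thesis
  proof (rule implicative_filterI)
    show "\<top>\<^bsub>H\<^esub> \<in> f -` F \<inter> carrier H"
      by (simp add: f(2) top_closed implicative_filter_top[OF F])
    fix a b
    assume "a \<in> carrier H" "b \<in> carrier H"
      and "a \<in> f -` F \<inter> carrier H" "a \<rightarrow>\<^bsub>H\<^esub> b \<in> f -` F \<inter> carrier H"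
    then show "b \<in> f -` F \<inter> carrier H"
      using implicative_filter_mp[OF F, of "f a" "f b"] by (simp add: f(1,3))
  qed simp
qed

lemma implicative_filter_Union_chain:
  assumes "C \<noteq> {}" and chain: "subset.chain {F. implicative_filter H F} C"
  shows "implicative_filter H (\<Union>C)"
proof (rule implicative_filterI)
  have filt: "implicative_filter H F" if "F \<in> C" for F
    using chain that by (auto simp: subset_chain_def)
  show "\<Union>C \<subseteq> carrier H"
    using filt implicative_filter_subset by blast
  show "\<top>\<^bsub>H\<^esub> \<in> \<Union>C"
    using filt assms(1) implicative_filter_top by blast
  fix a b
  assume b: "b \<in> carrier H" and "a \<in> \<Union>C" "a \<rightarrow>\<^bsub>H\<^esub> b \<in> \<Union>C"
  then obtain F1 F2 where F: "F1 \<in> C" "F2 \<in> C" "a \<in> F1" "a \<rightarrow>\<^bsub>H\<^esub> b \<in> F2"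
    by blast
  then have "F1 \<subseteq> F2 \<or> F2 \<subseteq> F1"
    using chain by (auto simp: subset_chain_def)
  then obtain F' where "F' \<in> C" "a \<in> F'" "a \<rightarrow>\<^bsub>H\<^esub> b \<in> F'"
    using F by blast
  then show "b \<in> \<Union>C"
    using implicative_filter_mp[OF filt _ b] by blast
qed

lemma ex_maximal_implicative_filter:
  assumes F: "implicative_filter H F" and "F \<inter> I = {}"
  obtains P where "implicative_filter H P" "F \<subseteq> P" "P \<inter> I = {}"
    "\<And>P'. \<lbrakk>implicative_filter H P'; P \<subseteq> P'; P' \<inter> I = {}\<rbrakk> \<Longrightarrow> P' = P"
proof -
  let ?A = "{P. implicative_filter H P \<and> F \<subseteq> P \<and> P \<inter> I = {}}"
  have "\<exists>P\<in>?A. \<forall>P'\<in>?A. P \<subseteq> P' \<longrightarrow> P' = P"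
  proof (rule subset_Zorn_nonempty)
    show "?A \<noteq> {}" using assms by blast
    fix C assume C: "C \<noteq> {}" "subset.chain ?A C"
    then have sub: "C \<subseteq> ?A" and "subset.chain {F. implicative_filter H F} C"
      by (auto simp: subset_chain_def)
    then have "implicative_filter H (\<Union>C)"
      by (intro implicative_filter_Union_chain C(1))
    with C(1) sub show "\<Union>C \<in> ?A" by blast
  qed
  then obtain P where P: "P \<in> ?A" and max: "\<forall>P'\<in>?A. P \<subseteq> P' \<longrightarrow> P' = P" ..
  show thesis
  proof (rule that)
    show "implicative_filter H P" "F \<subseteq> P" "P \<inter> I = {}"
      using P by simp_all
    show "P' = P" if "implicative_filter H P'" "P \<subseteq> P'" "P' \<inter> I = {}" for P'
    proof -
      have "P' \<in> ?A" using P that by auto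
      with max that(2) show ?thesis by simp
    qed
  qed
qed

text \<open>
  A filter maximal among those missing \<open>a\<close> is irreducible: two strictly larger filters both
  contain \<open>a\<close>, hence so does their intersection.
\<close>

lemma irreducible_separation:
  assumes F: "implicative_filter H F" and a: "a \<in> carrier H" "a \<notin> F"
  obtains P where "P \<in> X H" "F \<subseteq> P" "a \<notin> P"
proof -
  obtain P where P: "implicative_filter H P" "F \<subseteq> P" "P \<inter> {a} = {}"
    and max: "\<And>P'. \<lbrakk>implicative_filter H P'; P \<subseteq> P'; P' \<inter> {a} = {}\<rbrakk> \<Longrightarrow> P' = P"
    using ex_maximal_implicative_filter[OF F, of "{a}"] a by auto
  have "P = F1 \<or> P = F2"
    if "implicative_filter H F1" "implicative_filter H F2" "P = F1 \<inter> F2" for F1 F2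
    using max[of F1] max[of F2] that P(3) by blast
  with P a have "P \<in> X H"
    by (auto simp: X_def irreducible_filter_def)
  with P that show thesis by blast
qed

text \<open>
  Take \<open>P \<supseteq> F\<close> maximal with \<open>f\<^sup>-\<^sup>1(P) \<subseteq> Q\<close>. Adjoining \<open>f(q)\<close> to \<open>P\<close> for \<open>q \<in> Q\<close> keeps the preimage inside
  \<open>Q\<close>, because \<open>f(q) \<rightarrow> f(a) = f(q \<rightarrow> a)\<close> and \<open>Q\<close> is closed under modus ponens; so \<open>P\<close> already contains
  \<open>f(Q)\<close> and \<open>f\<^sup>-\<^sup>1(P) = Q\<close>. If \<open>P = F1 \<inter> F2\<close>, then \<open>Q\<close> is the intersection of the preimages of \<open>F1\<close>
  and \<open>F2\<close>, so irreducibility of \<open>Q\<close> makes one of these preimages equal to \<open>Q\<close>, and maximality of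
  \<open>P\<close> makes the corresponding filter equal to \<open>P\<close>.
\<close>

lemma irreducible_lifting:
  assumes H: "hilbert_algebra H" and G: "hilbert_algebra G" and hom: "f \<in> hilb_hom H G"
    and F: "implicative_filter G F" and Q: "Q \<in> X H" and sub: "f -` F \<inter> carrier H \<subseteq> Q"
  obtains P where "P \<in> X G" "F \<subseteq> P" "f -` P \<inter> carrier H = Q"
proof -
  have f: "\<And>a. a \<in> carrier H \<Longrightarrow> f a \<in> carrier G"
    "\<And>a b. \<lbrakk>a \<in> carrier H; b \<in> carrier H\<rbrakk> \<Longrightarrow> f (a \<rightarrow>\<^bsub>H\<^esub> b) = f a \<rightarrow>\<^bsub>G\<^esub> f b"
    using hom by (auto simp: hilb_hom_def)
  note Qf = X_implicative_filter[OF Q]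
  note QH = implicative_filter_subset[OF Qf]
  have avoid: "P \<inter> f ` (carrier H - Q) = {} \<longleftrightarrow> f -` P \<inter> carrier H \<subseteq> Q" for P
    by blast
  obtain P where P: "implicative_filter G P" "F \<subseteq> P" "f -` P \<inter> carrier H \<subseteq> Q"
    and max: "\<And>P'. \<lbrakk>implicative_filter G P'; P \<subseteq> P'; f -` P' \<inter> carrier H \<subseteq> Q\<rbrakk> \<Longrightarrow> P' = P"
    using ex_maximal_implicative_filter[OF F, of "f ` (carrier H - Q)"] sub
    unfolding avoid by blast
  have fQ: "f q \<in> P" if q: "q \<in> Q" for q
  proof -
    let ?P = "{b \<in> carrier G. f q \<rightarrow>\<^bsub>G\<^esub> b \<in> P}"
    have qH: "q \<in> carrier H" using q QH by blast
    note adj = adjoin_implicative_filter[OF G P(1) f(1)[OF qH]]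
    have "f -` ?P \<inter> carrier H \<subseteq> Q"
    proof
      fix a assume "a \<in> f -` ?P \<inter> carrier H"
      then have a: "a \<in> carrier H" "f (q \<rightarrow>\<^bsub>H\<^esub> a) \<in> P"
        using f(2)[OF qH] by auto
      then have "q \<rightarrow>\<^bsub>H\<^esub> a \<in> Q"
        using P(3) hilbert_algebra.imp_closed[OF H qH] by blast
      with a(1) q show "a \<in> Q"
        using implicative_filter_mp[OF Qf] by blast
    qed
    then have "?P = P" using max[OF adj(1,2)] by blast
    with adj(3) show ?thesis by blast
  qed
  have vim: "f -` P \<inter> carrier H = Q"
    using fQ P(3) QH by blast
  have "P = F1 \<or> P = F2"
    if Fs: "implicative_filter G F1" "implicative_filter G F2" "P = F1 \<inter> F2" for F1 F2
  proof -
    have "Q = (f -` F1 \<inter> carrier H) \<inter> (f -` F2 \<inter> carrier H)"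
      using vim Fs(3) by blast
    then have "Q = f -` F1 \<inter> carrier H \<or> Q = f -` F2 \<inter> carrier H"
      using Q vimage_implicative_filter[OF H hom] Fs(1,2)
      by (auto simp: X_def irreducible_filter_def)
    then show ?thesis
      using max[of F1] max[of F2] Fs by blast
  qed
  moreover have "P \<noteq> carrier G"
    using vim f(1) X_neq_carrier[OF Q] by blast
  ultimately have "P \<in> X G"
    using P(1) by (auto simp: X_def irreducible_filter_def)
  with P(2) vim that show thesis by blast
qed

section \<open>The implicative semilattice of a Hilbert algebra\<close>

lemma mem_X_imp: "P \<in> X_imp H U V \<longleftrightarrow> P \<in> X H \<and> (\<forall>Q\<in>X H. P \<subseteq> Q \<longrightarrow> Q \<in> U \<longrightarrow> Q \<in> V)"
  by (auto simp: X_imp_def X_down_def)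

lemma X_upsetsD: "\<lbrakk>U \<in> X_upsets H; P \<in> U; Q \<in> X H; P \<subseteq> Q\<rbrakk> \<Longrightarrow> Q \<in> U"
  by (auto simp: X_upsets_def)

lemma X_upsets_subset: "U \<in> X_upsets H \<Longrightarrow> U \<subseteq> X H"
  by (simp add: X_upsets_def)

lemma X_subsemilat_X_upsets: "X_subsemilat H (X_upsets H)"
  unfolding X_subsemilat_def by (auto simp: X_upsets_def mem_X_imp)

lemma phi_in_X_upsets: "phi H a \<in> X_upsets H"
  by (auto simp: phi_def X_upsets_def)

lemma carrier_IS_obj_least:
  "\<lbrakk>X_subsemilat H S; phi H ` carrier H \<subseteq> S\<rbrakk> \<Longrightarrow> carrier (IS_obj H) \<subseteq> S"
  by (auto simp: IS_obj_def)

lemma carrier_IS_obj_subset: "carrier (IS_obj H) \<subseteq> X_upsets H"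
  by (rule carrier_IS_obj_least[OF X_subsemilat_X_upsets]) (auto simp: phi_in_X_upsets)

lemma phi_in_carrier_IS_obj: "a \<in> carrier H \<Longrightarrow> phi H a \<in> carrier (IS_obj H)"
  by (auto simp: IS_obj_def)

lemma X_subsemilat_carrier_IS_obj: "X_subsemilat H (carrier (IS_obj H))"
  unfolding X_subsemilat_def
proof (intro conjI carrier_IS_obj_subset)
  show "X H \<in> carrier (IS_obj H)"
    by (simp add: IS_obj_def X_subsemilat_def)
  show "\<forall>U\<in>carrier (IS_obj H). \<forall>V\<in>carrier (IS_obj H). U \<inter> V \<in> carrier (IS_obj H)"
    by (simp add: IS_obj_def X_subsemilat_def)
  show "\<forall>U\<in>carrier (IS_obj H). \<forall>V\<in>carrier (IS_obj H). X_imp H U V \<in> carrier (IS_obj H)"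
    by (simp add: IS_obj_def X_subsemilat_def)
qed

lemma IS_obj_simps [simp]:
  "imp (IS_obj H) = X_imp H" "top_el (IS_obj H) = X H" "meet (IS_obj H) = (\<inter>)"
  by (simp_all add: IS_obj_def)

lemma X_upsets_residuation:
  assumes "U \<in> X_upsets H"
  shows "U \<inter> V \<subseteq> W \<longleftrightarrow> U \<subseteq> X_imp H V W"
  using assms X_upsets_subset[OF assms] by (auto simp: mem_X_imp subset_iff dest: X_upsetsD)

lemma implicative_semilattice_IS_obj: "implicative_semilattice (IS_obj H)"
proof -
  have closed: "X H \<in> carrier (IS_obj H)"
    "\<And>U V. \<lbrakk>U \<in> carrier (IS_obj H); V \<in> carrier (IS_obj H)\<rbrakk> \<Longrightarrow> U \<inter> V \<in> carrier (IS_obj H)"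
    "\<And>U V. \<lbrakk>U \<in> carrier (IS_obj H); V \<in> carrier (IS_obj H)\<rbrakk> \<Longrightarrow> X_imp H U V \<in> carrier (IS_obj H)"
    using X_subsemilat_carrier_IS_obj[of H] by (simp_all add: X_subsemilat_def)
  have up: "U \<in> X_upsets H" if "U \<in> carrier (IS_obj H)" for U
    using that carrier_IS_obj_subset by blast
  show ?thesis
  proof
    fix a b c
    show "a \<sqinter>\<^bsub>IS_obj H\<^esub> b \<sqsubseteq>\<^bsub>IS_obj H\<^esub> c \<longleftrightarrow> a \<sqsubseteq>\<^bsub>IS_obj H\<^esub> b \<rightarrow>\<^bsub>IS_obj H\<^esub> c"
      if "a \<in> carrier (IS_obj H)"
      using X_upsets_residuation[OF up[OF that], of b c]
      by (simp add: meet_le_def inf.absorb_iff1)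
    show "a \<sqsubseteq>\<^bsub>IS_obj H\<^esub> \<top>\<^bsub>IS_obj H\<^esub>" if "a \<in> carrier (IS_obj H)"
      using X_upsets_subset[OF up[OF that]] by (simp add: meet_le_def inf.absorb_iff1)
  qed (auto simp: closed)
qed

section \<open>The box operator of a homomorphism\<close>

text \<open>
  \<open>IS_map\<close> without the restriction to the generated subsemilattice, so that it can be applied to
  all upsets.
\<close>

definition R_box :: "'a hilb \<Rightarrow> 'b hilb \<Rightarrow> ('a \<Rightarrow> 'b) \<Rightarrow> 'a set set \<Rightarrow> 'b set set" where
  "R_box H G f U = {P \<in> X G. R_rel H G f `` {P} \<subseteq> U}"

lemma IS_map_eq: "IS_map H G f = restrict (R_box H G f) (carrier (IS_obj H))"
  unfolding IS_map_def R_box_def by (rule refl)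

lemma mem_R_box:
  "P \<in> R_box H G f U \<longleftrightarrow> P \<in> X G \<and> (\<forall>Q\<in>X H. f -` P \<inter> carrier H \<subseteq> Q \<longrightarrow> Q \<in> U)"
  by (auto simp: R_box_def R_rel_def)

lemma R_box_X: "R_box H G f (X H) = X G"
  by (auto simp: mem_R_box)

lemma R_box_Int: "R_box H G f (U \<inter> V) = R_box H G f U \<inter> R_box H G f V"
  by (auto simp: mem_R_box)

lemma R_box_phi:
  assumes H: "hilbert_algebra H" and hom: "f \<in> hilb_hom H G" and a: "a \<in> carrier H"
  shows "R_box H G f (phi H a) = phi G (f a)"
proof (intro Set.set_eqI iffI)
  fix P assume P: "P \<in> R_box H G f (phi H a)"
  then have PX: "P \<in> X G" by (simp add: mem_R_box)
  note filt = vimage_implicative_filter[OF H hom X_implicative_filter[OF PX]]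
  have "a \<in> f -` P \<inter> carrier H"
  proof (rule ccontr)
    assume "a \<notin> f -` P \<inter> carrier H"
    then obtain Q where "Q \<in> X H" "f -` P \<inter> carrier H \<subseteq> Q" "a \<notin> Q"
      using irreducible_separation[OF filt a] by blast
    with P show False by (auto simp: mem_R_box phi_def)
  qed
  with PX show "P \<in> phi G (f a)" by (simp add: phi_def)
next
  fix P assume "P \<in> phi G (f a)"
  then have P: "P \<in> X G" and "a \<in> f -` P \<inter> carrier H"
    using a by (simp_all add: phi_def)
  then have "\<forall>Q\<in>X H. f -` P \<inter> carrier H \<subseteq> Q \<longrightarrow> Q \<in> phi H a"
    by (simp add: phi_def subset_iff)
  with P show "P \<in> R_box H G f (phi H a)"
    by (simp add: mem_R_box)
qed

lemma R_box_X_imp: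
  assumes H: "hilbert_algebra H" and G: "hilbert_algebra G" and hom: "f \<in> hilb_hom H G"
    and U: "U \<in> X_upsets H"
  shows "R_box H G f (X_imp H U V) = X_imp G (R_box H G f U) (R_box H G f V)"
proof (intro Set.set_eqI iffI)
  fix P assume P: "P \<in> R_box H G f (X_imp H U V)"
  have "P' \<in> R_box H G f V" if P': "P' \<in> X G" "P \<subseteq> P'" "P' \<in> R_box H G f U" for P'
    unfolding mem_R_box
  proof (intro conjI ballI impI P'(1))
    fix Q assume Q: "Q \<in> X H" "f -` P' \<inter> carrier H \<subseteq> Q"
    moreover have "f -` P \<inter> carrier H \<subseteq> Q" using Q(2) P'(2) by auto
    ultimately have "Q \<in> X_imp H U V" "Q \<in> U"
      using P P'(3) by (simp_all add: mem_R_box)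
    with Q(1) show "Q \<in> V" by (simp add: mem_X_imp)
  qed
  moreover have "P \<in> X G" using P by (simp add: mem_R_box)
  ultimately show "P \<in> X_imp G (R_box H G f U) (R_box H G f V)"
    by (simp add: mem_X_imp)
next
  fix P assume P: "P \<in> X_imp G (R_box H G f U) (R_box H G f V)"
  then have PX: "P \<in> X G" by (simp add: mem_X_imp)
  \<comment> \<open>Lifting gives \<open>P' \<supseteq> P\<close> for which \<open>R_f(P')\<close> is the principal upset of \<open>Q\<close>; this lies in \<open>U\<close> because
    \<open>Q\<close> does, so the implication between the boxes can be used at \<open>P'\<close>.\<close>
  have main: "Q \<in> V" if Q: "Q \<in> X H" "f -` P \<inter> carrier H \<subseteq> Q" "Q \<in> U" for Q
  proof -
    obtain P' where P': "P' \<in> X G" "P \<subseteq> P'" "f -` P' \<inter> carrier H = Q"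
      using irreducible_lifting[OF H G hom X_implicative_filter[OF PX] Q(1,2)] .
    then have "P' \<in> R_box H G f U"
      using X_upsetsD[OF U Q(3)] by (simp add: mem_R_box)
    with P P'(1,2) have "P' \<in> R_box H G f V" by (simp add: mem_X_imp)
    with P'(3) Q(1) show "Q \<in> V" by (simp add: mem_R_box)
  qed
  show "P \<in> R_box H G f (X_imp H U V)"
    unfolding mem_R_box mem_X_imp
  proof (intro conjI ballI impI PX)
    fix Q Q' assume "f -` P \<inter> carrier H \<subseteq> Q" "Q \<subseteq> Q'" and Q': "Q' \<in> X H" "Q' \<in> U"
    then have "f -` P \<inter> carrier H \<subseteq> Q'" by simp
    with Q' main show "Q' \<in> V" by simp
  qed
qed

lemma R_box_id:
  assumes "U \<in> X_upsets H"
  shows "R_box H H (\<lambda>a\<in>carrier H. a) U = U"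
proof -
  have "(\<lambda>a\<in>carrier H. a) -` P \<inter> carrier H = P" if "P \<in> X H" for P
    using implicative_filter_subset[OF X_implicative_filter[OF that]] by auto
  then show ?thesis
    using X_upsetsD[OF assms] X_upsets_subset[OF assms] by (auto simp: mem_R_box)
qed

text \<open>
  The inclusion from right to left needs, for \<open>Q \<supseteq> f\<^sup>-\<^sup>1(g\<^sup>-\<^sup>1(P))\<close>, an irreducible filter \<open>P' \<supseteq> g\<^sup>-\<^sup>1(P)\<close> with
  \<open>f\<^sup>-\<^sup>1(P') \<subseteq> Q\<close>. Lifting \<open>Q\<close> over the filter \<open>g\<^sup>-\<^sup>1(P)\<close>, which may fail to be irreducible, provides one.
\<close>

lemma R_box_compose:
  assumes H: "hilbert_algebra H" and G: "hilbert_algebra G"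
    and f: "f \<in> hilb_hom H G" and g: "g \<in> hilb_hom G K"
  shows "R_box H K (compose (carrier H) g f) U = R_box G K g (R_box H G f U)"
proof -
  have fG: "f a \<in> carrier G" if "a \<in> carrier H" for a
    using f that by (auto simp: hilb_hom_def)
  have vim: "compose (carrier H) g f -` P \<inter> carrier H = f -` (g -` P \<inter> carrier G) \<inter> carrier H" for P
    using fG by (auto simp: compose_def)
  have main: "(\<forall>Q\<in>X H. f -` (g -` P \<inter> carrier G) \<inter> carrier H \<subseteq> Q \<longrightarrow> Q \<in> U) \<longleftrightarrow>
    (\<forall>P'\<in>X G. g -` P \<inter> carrier G \<subseteq> P' \<longrightarrow> (\<forall>Q\<in>X H. f -` P' \<inter> carrier H \<subseteq> Q \<longrightarrow> Q \<in> U))"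
    (is "?L \<longleftrightarrow> ?R") if P: "P \<in> X K" for P
  proof
    assume L: ?L
    show ?R
    proof (intro ballI impI)
      fix P' Q assume "g -` P \<inter> carrier G \<subseteq> P'" "f -` P' \<inter> carrier H \<subseteq> Q" and Q: "Q \<in> X H"
      then have "f -` (g -` P \<inter> carrier G) \<inter> carrier H \<subseteq> Q" by auto
      with L Q show "Q \<in> U" by simp
    qed
  next
    assume R: ?R
    show ?L
    proof (intro ballI impI)
      fix Q assume Q: "Q \<in> X H" "f -` (g -` P \<inter> carrier G) \<inter> carrier H \<subseteq> Q"
      note filt = vimage_implicative_filter[OF G g X_implicative_filter[OF P]]
      obtain P' where "P' \<in> X G" "g -` P \<inter> carrier G \<subseteq> P'" "f -` P' \<inter> carrier H = Q"
        using irreducible_lifting[OF H G f filt Q] .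
      with R Q(1) show "Q \<in> U" by blast
    qed
  qed
  show ?thesis
  proof (rule Set.set_eqI)
    fix P
    show "P \<in> R_box H K (compose (carrier H) g f) U \<longleftrightarrow> P \<in> R_box G K g (R_box H G f U)"
      unfolding mem_R_box vim using main[of P] by auto
  qed
qed

lemma R_box_in_carrier_IS_obj:
  assumes H: "hilbert_algebra H" and G: "hilbert_algebra G" and hom: "f \<in> hilb_hom H G"
    and U: "U \<in> carrier (IS_obj H)"
  shows "R_box H G f U \<in> carrier (IS_obj G)"
proof -
  let ?S = "{U \<in> X_upsets H. R_box H G f U \<in> carrier (IS_obj G)}"
  have "X_subsemilat H ?S"
    using X_subsemilat_X_upsets[of H] X_subsemilat_carrier_IS_obj[of G]
    by (auto simp: X_subsemilat_def R_box_X R_box_Int R_box_X_imp[OF H G hom])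
  moreover have "phi H ` carrier H \<subseteq> ?S"
    using hom by (auto simp: phi_in_X_upsets R_box_phi[OF H hom] hilb_hom_def
        intro!: phi_in_carrier_IS_obj)
  ultimately show ?thesis
    using carrier_IS_obj_least[of H ?S] U by blast
qed

section \<open>Functoriality\<close>

lemma IS_map_hom:
  assumes "hilbert_algebra H" and "hilbert_algebra G" and "f \<in> hilb_hom H G"
  shows "IS_map H G f \<in> imp_semilat_hom (IS_obj H) (IS_obj G)"
proof -
  interpret L: implicative_semilattice "IS_obj H" by (rule implicative_semilattice_IS_obj)
  show ?thesis
    using L.top_closed L.meet_closed L.imp_closed carrier_IS_obj_subset[of H]
    by (auto simp: imp_semilat_hom_def IS_map_eq R_box_in_carrier_IS_obj[OF assms] R_box_X
        R_box_Int R_box_X_imp[OF assms] subset_iff)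
qed

lemma IS_map_id: "IS_map H H (\<lambda>a\<in>carrier H. a) = (\<lambda>U\<in>carrier (IS_obj H). U)"
  unfolding IS_map_eq using carrier_IS_obj_subset[of H]
  by (intro restrict_ext R_box_id) blast

lemma IS_map_compose:
  assumes "hilbert_algebra H" and "hilbert_algebra G"
    and "f \<in> hilb_hom H G" and "g \<in> hilb_hom G K"
  shows "IS_map H K (compose (carrier H) g f) =
    compose (carrier (IS_obj H)) (IS_map G K g) (IS_map H G f)"
  unfolding IS_map_eq compose_def[of "carrier (IS_obj H)"]
  by (intro restrict_ext) (simp add: R_box_compose[OF assms] R_box_in_carrier_IS_obj[OF assms(1-3)])

theorem proposition1:
  "cat_functor (Hil :: ('a hilb, 'a \<Rightarrow> 'a) cat)
     (IS :: ('a set set imp_semilat, 'a set set \<Rightarrow> 'a set set) cat) IS_obj IS_map"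
  by (intro cat_functor.intro cat_functor_axioms.intro category_Hil category_IS)
    (simp_all add: Hil_def IS_def implicative_semilattice_IS_obj IS_map_hom IS_map_id
      IS_map_compose)

end
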